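(* For every instance of the strategic facility location game in an arbitrary metric space (with a finite set of facility locations and with $k$ strategic clients among $n$ clients), there exists a (pure) Nash equilibrium under Mechanism $GM^*$.
   Context: Setting. An instance consists of a metric space with distance $d$; a set $\mathcal{C}$ of $n$ clients, each having a true location in the metric space (several clients may share a location; the true location of client $i$ is also denoted $i$); a finite nonempty set $\mathcal{F}$ of possible facility locations in the metric space, equipped with a fixed total ordering (an element earlier in the ordering is called lower-numbered); and a partition $\mathcal{C}=T\cup L$, $T\cap L=\emptyset$, with $|L|=k\ge 1$, $|T|=n-k$. Clients in $T$ always report their true location; each client $i\in L$ (strategic) may report any point $x_i$ of the metric space. Let $\vec t$ be the vector of true locations of clients in $T$ and $\vec x=(x_i)_{i\in L}$ the vector of reports of the strategic clients. Perceived cost of $A\in\mathcal{F}$: $cost_A(\vec t;\vec x)=\sum_{i\in T}d(i,A)+\sum_{i\in L}d(x_i,A)$. Mechanism $GM^*$: given reports $(\vec t;\vec x)$, output the facility $GM^*(\vec t;\vec x)\in\mathcal{F}$ minimizing $cost_A(\vec t;\vec x)$ over $A\in\mathcal{F}$, ties broken in favor of the lowest-numbered facility. Nash equilibrium (NE) under a mechanism $M$: a profile $(\vec t;\vec x)$ such that for every $i\in L$ and every point $x_i'$ of the metric space, $d(i,M(\vec t;\vec x_{-i},x_i'))\ge d(i,M(\vec t;\vec x))$, where $(\vec x_{-i},x_i')$ is $\vec x$ with $i$'s report replaced by $x_i'$. *)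

theory Defs
  imports "HOL-Analysis.Analysis"
begin

text \<open>
  The metric space is an explicit carrier \<open>M\<close> with distance \<open>d\<close>. Clients are abstract names, so
  that several of them may share a true location \<open>loc i\<close>; facilities are points of the metric
  space. \<open>(A, B) \<in> r\<close> means that \<open>A\<close> is lower-numbered than or equal to \<open>B\<close>.
\<close>

locale facility_location_game = Metric_space M d
  for M :: "'a set" and d :: "'a \<Rightarrow> 'a \<Rightarrow> real" +
  fixes C T L :: "'c set" and loc :: "'c \<Rightarrow> 'a" and F :: "'a set" and r :: "'a rel"
    and n k :: nat
  assumes finite_clients: "finite C"
    and card_clients: "card C = n"
    and loc_in_space: "loc \<in> C \<rightarrow> M"
    and clients_partition: "T \<union> L = C" "T \<inter> L = {}"
    and card_strategic: "card L = k"
    and k_ge_1: "k \<ge> 1"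
    and facilities_in_space: "F \<subseteq> M"
    and finite_facilities: "finite F"
    and facilities_nonempty: "F \<noteq> {}"
    and facility_order: "linear_order_on F r"

text \<open>
  Below, \<open>t\<close> and \<open>x\<close> are the report vectors indexed by \<open>T\<close> and by \<open>L\<close> respectively.
\<close>

definition perceived_cost ::
    "('a \<Rightarrow> 'a \<Rightarrow> real) \<Rightarrow> 'c set \<Rightarrow> 'c set \<Rightarrow> ('c \<Rightarrow> 'a) \<Rightarrow> ('c \<Rightarrow> 'a) \<Rightarrow> 'a \<Rightarrow> real" where
  "perceived_cost d T L t x A = (\<Sum>i\<in>T. d (t i) A) + (\<Sum>i\<in>L. d (x i) A)"

definition minimizers :: "'a set \<Rightarrow> ('a \<Rightarrow> real) \<Rightarrow> 'a set" where
  "minimizers F f = {A \<in> F. \<forall>B\<in>F. f A \<le> f B}"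

definition GM_star ::
    "('a \<Rightarrow> 'a \<Rightarrow> real) \<Rightarrow> 'c set \<Rightarrow> 'c set \<Rightarrow> 'a set \<Rightarrow> 'a rel \<Rightarrow> ('c \<Rightarrow> 'a) \<Rightarrow> ('c \<Rightarrow> 'a) \<Rightarrow> 'a" where
  "GM_star d T L F r t x =
     (THE A. A \<in> minimizers F (perceived_cost d T L t x) \<and>
             (\<forall>B\<in>minimizers F (perceived_cost d T L t x). (A, B) \<in> r))"

definition nash_equilibrium ::
    "'a set \<Rightarrow> ('a \<Rightarrow> 'a \<Rightarrow> real) \<Rightarrow> 'c set \<Rightarrow> ('c \<Rightarrow> 'a) \<Rightarrow>
     (('c \<Rightarrow> 'a) \<Rightarrow> ('c \<Rightarrow> 'a) \<Rightarrow> 'a) \<Rightarrow> ('c \<Rightarrow> 'a) \<Rightarrow> ('c \<Rightarrow> 'a) \<Rightarrow> bool" where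
  "nash_equilibrium M d L loc mech t x \<longleftrightarrow>
     x \<in> L \<rightarrow>\<^sub>E M \<and>
     (\<forall>i\<in>L. \<forall>x'\<in>M. d (loc i) (mech t (x(i := x'))) \<ge> d (loc i) (mech t x))"

lemma ex1_least_linear_order_on:
  assumes "linear_order_on F r" "finite S" "S \<noteq> {}" "S \<subseteq> F"
  shows "\<exists>!A. A \<in> S \<and> (\<forall>B\<in>S. (A, B) \<in> r)"
proof -
  have refl: "(a, a) \<in> r" if "a \<in> F" for a
    using assms(1) that by (auto simp: order_on_defs refl_on_def)
  have tot: "(a, b) \<in> r \<or> (b, a) \<in> r" if "a \<in> F" "b \<in> F" for a b
    using assms(1) that refl by (cases "a = b") (auto simp: order_on_defs total_on_def)
  have tr: "trans r" and an: "antisym r"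
    using assms(1) by (auto simp: order_on_defs)
  have "\<exists>A. A \<in> S \<and> (\<forall>B\<in>S. (A, B) \<in> r)"
    using assms(2-4)
  proof (induction S rule: finite_ne_induct)
    case (singleton a)
    then show ?case using refl by auto
  next
    case (insert a S)
    then obtain A where A: "A \<in> S" "\<forall>B\<in>S. (A, B) \<in> r" by auto
    show ?case
    proof (cases "(A, a) \<in> r")
      case True
      then show ?thesis using A by auto
    next
      case False
      then have "(a, A) \<in> r" "(a, a) \<in> r" using tot[of a A] refl[of a] A(1) insert.prems by auto
      then have "(a, B) \<in> r" if "B \<in> S" for B
        using A(2) that tr unfolding trans_def by metis
      with \<open>(a, a) \<in> r\<close> show ?thesis by auto
    qed
  qed
  then obtain A where A: "A \<in> S" "\<forall>B\<in>S. (A, B) \<in> r" by blast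
  have uniq: "A' = A" if "A' \<in> S" "\<forall>B\<in>S. (A', B) \<in> r" for A'
    using that A antisymD[OF an, of A' A] by simp
  show ?thesis
  proof (rule ex1I[of _ A])
    show "A \<in> S \<and> (\<forall>B\<in>S. (A, B) \<in> r)" using A by (rule conjI)
  next
    fix A'
    assume "A' \<in> S \<and> (\<forall>B\<in>S. (A', B) \<in> r)"
    then show "A' = A" using uniq by (elim conjE)
  qed
qed

text \<open>The description defining \<open>GM_star\<close> always denotes.\<close>

lemma (in facility_location_game) GM_star_least_minimizer:
  fixes t x :: "'c \<Rightarrow> 'a"
  shows "GM_star d T L F r t x \<in> minimizers F (perceived_cost d T L t x)"
    and "\<And>B. B \<in> minimizers F (perceived_cost d T L t x) \<Longrightarrow> (GM_star d T L F r t x, B) \<in> r"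
proof -
  let ?f = "perceived_cost d T L t x"
  have "arg_min_on ?f F \<in> minimizers F ?f"
    using arg_min_least[OF finite_facilities facilities_nonempty, of _ ?f]
      arg_min_if_finite(1)[OF finite_facilities facilities_nonempty, of ?f]
    by (simp add: minimizers_def)
  then have ne: "minimizers F ?f \<noteq> {}" by auto
  have fin: "finite (minimizers F ?f)" and sub: "minimizers F ?f \<subseteq> F"
    using finite_facilities by (auto simp: minimizers_def)
  have
    "\<exists>!A. A \<in> minimizers F ?f \<and> (\<forall>B\<in>minimizers F ?f. (A, B) \<in> r)"
    by (rule ex1_least_linear_order_on[OF facility_order fin ne sub])
  from theI'[OF this, folded GM_star_def]
  show "GM_star d T L F r t x \<in> minimizers F ?f"
    and "\<And>B. B \<in> minimizers F ?f \<Longrightarrow> (GM_star d T L F r t x, B) \<in> r"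
    by simp_all
qed

end

theory Submission
  imports Defs
begin

text \<open>
  With a single strategic client the mechanism has only finitely many outcomes, so a best response
  exists. With at least two, let all of them report the facility \<open>A\<close> that the truthful clients
  alone would elect. When one of them deviates to \<open>x'\<close>, another still reports \<open>A\<close>, and
  \<open>d A B + d x' B \<ge> d x' A\<close> shows that no facility \<open>B\<close> can overtake \<open>A\<close>.
\<close>

context facility_location_game
begin

lemma GM_star_in_facilities: "GM_star d T L F r t x \<in> F"
  using GM_star_least_minimizer(1)[of t x] by (simp add: minimizers_def)

text \<open>Kept general in \<open>f\<close> because the election by the truthful clients alone uses
  a cost without the strategic reports.\<close>

lemma obtain_least_minimizer:
  fixes f :: "'a \<Rightarrow> real"
  obtains A where "A \<in> minimizers F f" "\<And>B. B \<in> minimizers F f \<Longrightarrow> (A, B) \<in> r"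
proof -
  have "arg_min_on f F \<in> minimizers F f"
    using arg_min_least[OF finite_facilities facilities_nonempty, of _ f]
      arg_min_if_finite(1)[OF finite_facilities facilities_nonempty, of f]
    by (simp add: minimizers_def)
  moreover have "finite (minimizers F f)" "minimizers F f \<subseteq> F"
    using finite_facilities by (auto simp: minimizers_def)
  ultimately show thesis
    using ex1_least_linear_order_on[OF facility_order, of "minimizers F f"] that by blast
qed

lemma best_response_exists:
  "\<exists>a\<in>M. \<forall>a'\<in>M. d (loc i) (GM_star d T L F r t (x(i := a)))
                  \<le> d (loc i) (GM_star d T L F r t (x(i := a')))"
proof -
  let ?g = "\<lambda>a. d (loc i) (GM_star d T L F r t (x(i := a)))"
  \<comment> \<open>\<open>M\<close> may be infinite, but the values of \<open>?g\<close> are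
    distances from \<open>loc i\<close> to facilities.\<close>
  have fin: "finite (?g ` M)"
    using finite_facilities GM_star_in_facilities
    by (intro finite_subset[of "?g ` M" "d (loc i) ` F"]) auto
  have "M \<noteq> {}"
    using facilities_nonempty facilities_in_space by auto
  then have "Min (?g ` M) \<in> ?g ` M"
    using fin by (intro Min_in) auto
  then obtain a where "a \<in> M" "?g a = Min (?g ` M)"
    by (metis (no_types, lifting) imageE)
  then show ?thesis
    using fin by (metis (no_types, lifting) Min_le imageI)
qed

lemma GM_star_unanimous_deviation:
  fixes t :: "'c \<Rightarrow> 'a"
  defines "f \<equiv> \<lambda>B. \<Sum>j\<in>T. d (t j) B"
  assumes A: "A \<in> minimizers F f" and least: "\<And>B. B \<in> minimizers F f \<Longrightarrow> (A, B) \<in> r"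
    and k: "k \<ge> 2" and i: "i \<in> L" and x': "x' \<in> M"
  shows "GM_star d T L F r t ((restrict (\<lambda>_. A) L)(i := x')) = A"
proof -
  let ?x = "(restrict (\<lambda>_. A) L)(i := x')"
  let ?c = "perceived_cost d T L t ?x"
  let ?W = "GM_star d T L F r t ?x"
  have AF: "A \<in> F" and fA: "\<And>B. B \<in> F \<Longrightarrow> f A \<le> f B"
    using A by (auto simp: minimizers_def)
  have W: "?W \<in> minimizers F ?c"
    by (rule GM_star_least_minimizer)
  have AM: "A \<in> M" and WM: "?W \<in> M"
    using AF GM_star_in_facilities facilities_in_space by auto
  have finL: "finite L"
    using k card_strategic by (metis card.infinite not_numeral_le_zero)
  \<comment> \<open>The other \<open>k - 1\<close> strategic clients sit at \<open>A\<close>; the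
    deviator contributes the last term.\<close>
  have cost: "?c B = f B + real (k - 1) * d A B + d x' B" for B
  proof -
    have "(\<Sum>j\<in>L - {i}. d (?x j) B) = (\<Sum>j\<in>L - {i}. d A B)"
      by (rule sum.cong) auto
    then show ?thesis
      using i finL card_strategic
      by (simp add: perceived_cost_def f_def sum.remove[OF finL i])
  qed
  have "?c ?W \<le> ?c A"
    using W AF by (auto simp: minimizers_def)
  then have le: "f ?W + real (k - 1) * d A ?W + d x' ?W \<le> f A + d x' A"
    using AM by (simp add: cost)
  \<comment> \<open>Here \<open>k \<ge> 2\<close> enters: at least one other strategic client still
    reports \<open>A\<close>.\<close>
  have "1 * d A ?W \<le> real (k - 1) * d A ?W"
    using k by (intro mult_right_mono) auto
  moreover have "d x' A \<le> d A ?W + d x' ?W"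
    using triangle[OF x' WM AM] commute[of A ?W] by simp
  moreover have "f A \<le> f ?W"
    by (rule fA[OF GM_star_in_facilities])
  moreover have "?c A = f A + d x' A"
    using AM by (simp add: cost)
  \<comment> \<open>Chaining \<open>le\<close> with the triangle inequality forces ties:
    \<open>A\<close> and the winner have equal cost under \<open>f\<close> and under
    \<open>?c\<close>.\<close>
  ultimately have fW: "f ?W \<le> f A" and cA: "?c A \<le> ?c ?W"
    using le unfolding cost[of ?W] by linarith+
  \<comment> \<open>Both elections break ties by the same order: the one for \<open>f\<close> puts
    \<open>A\<close> before the winner, the one for \<open>?c\<close> puts the winner before
    \<open>A\<close>, so antisymmetry identifies them.\<close>
  have "?W \<in> minimizers F f"
    using fW fA GM_star_in_facilities by (fastforce simp: minimizers_def)
  then have "(A, ?W) \<in> r"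
    by (rule least)
  moreover have "A \<in> minimizers F ?c"
    using W cA AF by (fastforce simp: minimizers_def)
  then have "(?W, A) \<in> r"
    by (rule GM_star_least_minimizer)
  ultimately show ?thesis
    using facility_order by (auto simp: order_on_defs dest: antisymD)
qed

lemma nash_equilibrium_exists: "\<exists>x. nash_equilibrium M d L loc (GM_star d T L F r) t x"
proof (cases "k = 1")
  case True
  then obtain i where L: "L = {i}"
    using card_strategic card_1_singletonE by blast
  \<comment> \<open>The base value \<open>undefined\<close> makes the profile extensional on
    \<open>L\<close>; a deviation by \<open>i\<close> merely overwrites \<open>a\<close>.\<close>
  obtain a where "a \<in> M" and
    "\<forall>a'\<in>M. d (loc i) (GM_star d T L F r t ((\<lambda>_. undefined)(i := a)))
            \<le> d (loc i) (GM_star d T L F r t ((\<lambda>_. undefined)(i := a')))"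
    using best_response_exists by blast
  then have "nash_equilibrium M d L loc (GM_star d T L F r) t ((\<lambda>_. undefined)(i := a))"
    by (auto simp: nash_equilibrium_def L split: if_splits)
  then show ?thesis
    by blast
next
  case False
  then have k: "k \<ge> 2"
    using k_ge_1 by simp
  obtain A where A: "A \<in> minimizers F (\<lambda>B. \<Sum>j\<in>T. d (t j) B)"
      "\<And>B. B \<in> minimizers F (\<lambda>B. \<Sum>j\<in>T. d (t j) B) \<Longrightarrow> (A, B) \<in> r"
    using obtain_least_minimizer[of "\<lambda>B. \<Sum>j\<in>T. d (t j) B"] by blast
  have AM: "A \<in> M"
    using A(1) facilities_in_space by (auto simp: minimizers_def)
  let ?x = "restrict (\<lambda>_. A) L"
  have dev: "GM_star d T L F r t (?x(i := x')) = A" if "i \<in> L" "x' \<in> M" for i x'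
    using GM_star_unanimous_deviation[OF A k that] .
  \<comment> \<open>Deviating to \<open>A\<close> itself changes nothing, so \<open>dev\<close> also
    gives the outcome of the original profile.\<close>
  have "GM_star d T L F r t ?x = A" if "i \<in> L" for i
    using dev[OF that AM] that by (simp add: fun_upd_idem)
  then have "nash_equilibrium M d L loc (GM_star d T L F r) t ?x"
    using AM dev by (auto simp: nash_equilibrium_def)
  then show ?thesis
    by blast
qed

end

theorem theorem3p2:
  fixes M :: "'a set" and d :: "'a \<Rightarrow> 'a \<Rightarrow> real"
    and C T L :: "'c set" and loc :: "'c \<Rightarrow> 'a"
    and F :: "'a set" and r :: "'a rel" and n k :: nat
  assumes "facility_location_game M d C T L loc F r n k"
  shows "\<exists>x. nash_equilibrium M d L loc (GM_star d T L F r) (restrict loc T) x"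
  using assms by (rule facility_location_game.nash_equilibrium_exists)

end
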